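(* Let $\Delta$ be a finite simplicial complex on $V$ and $\kappa\colon V\to[k]$ a $k$-linear coloring. Let $\Gamma=\Gamma(\Delta,\kappa)=\{S_\kappa: S\in\Delta\}$ and let $\Delta(\Gamma)$ be the simplicial complex constructed from $\Gamma$ as described in the context. Then $\Delta(\Gamma)$ is isomorphic to $\Delta$ as a simplicial complex.
   Context: $[k]=\{1,\dots,k\}$. A multiset on $[k]$ is a function $M\colon[k]\to\mathbb{N}$; $M'\subseteq M$ means $M'(t)\le M(t)$ for all $t$; $\|M\|=\sum_tM(t)$, $(M\cap M')(t)=\min(M(t),M'(t))$. For a face $S$ of $\Delta$, $S_\kappa$ is the multiset with $S_\kappa(t)=|\{v\in S:\kappa(v)=t\}|$. A $k$-linear coloring is a surjective $\kappa\colon V\to[k]$ with $\|F_\kappa\cap F'_\kappa\|=|F\cap F'|$ for all facets (maximal faces) $F,F'$ of $\Delta$. Construction of $\Delta(\Gamma)$ from a collection $\Gamma$ of multisets on $[k]$ closed under submultisets: for $i\in[k]$ put $n_i=\max\{M(i):M\in\Gamma\}$ and $V_i=\{a^i_r:1\le r\le n_i\}$; for $M\in\Gamma$ let $S_M=\{a^i_r: i\in[k],\ 1\le r\le M(i)\}$; $\Delta(\Gamma)$ is the simplicial complex on $\bigcup_iV_i$ generated by the sets $S_M$ for $M$ maximal in $\Gamma$ (its faces are the subsets of such $S_M$). *)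

theory Defs
  imports Main "HOL-Library.Multiset"
begin

text \<open>
  Abstract finite simplicial complexes with vertex set exactly \<open>V\<close>: every vertex is a face.
  For nonempty \<open>V\<close> the empty face is automatically present.
\<close>
definition simplicial_complex_on :: "'v set \<Rightarrow> 'v set set \<Rightarrow> bool" where
  "simplicial_complex_on V \<Delta> \<longleftrightarrow>
     finite V \<and> \<Delta> \<subseteq> Pow V \<and> (\<forall>v\<in>V. {v} \<in> \<Delta>) \<and> (\<forall>S\<in>\<Delta>. \<forall>T. T \<subseteq> S \<longrightarrow> T \<in> \<Delta>)"

definition facets :: "'v set set \<Rightarrow> 'v set set" where
  "facets \<Delta> = {F \<in> \<Delta>. \<forall>G\<in>\<Delta>. F \<subseteq> G \<longrightarrow> F = G}"

definition simplicial_isomorphic ::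
    "'v set \<Rightarrow> 'v set set \<Rightarrow> 'w set \<Rightarrow> 'w set set \<Rightarrow> bool" where
  "simplicial_isomorphic V \<Delta> W \<Delta>' \<longleftrightarrow>
     (\<exists>f. bij_betw f V W \<and> (\<forall>S. S \<subseteq> V \<longrightarrow> (S \<in> \<Delta> \<longleftrightarrow> f ` S \<in> \<Delta>')))"

text \<open>
  Multisets on \<open>[k] = {1..k}\<close> are elements of \<open>nat multiset\<close> supported in \<open>{1..k}\<close>; inclusion,
  size and intersection are \<open>\<subseteq>#\<close>, \<open>size\<close> and \<open>\<inter>#\<close>. The lemma \<open>count_color_mset\<close> below gives
  the multiplicities of the multiset of colors of a face.
\<close>
definition color_mset :: "('v \<Rightarrow> nat) \<Rightarrow> 'v set \<Rightarrow> nat multiset" where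
  "color_mset \<kappa> S = image_mset \<kappa> (mset_set S)"

lemma count_color_mset:
  assumes "finite S"
  shows "count (color_mset \<kappa> S) t = card {v \<in> S. \<kappa> v = t}"
proof -
  have "count (color_mset \<kappa> S) t = (\<Sum>v\<in>\<kappa> -` {t} \<inter> S. 1)"
    using assms by (simp add: color_mset_def count_image_mset)
  also have "\<kappa> -` {t} \<inter> S = {v \<in> S. \<kappa> v = t}" by auto
  finally show ?thesis by simp
qed

definition linear_coloring :: "'v set \<Rightarrow> 'v set set \<Rightarrow> nat \<Rightarrow> ('v \<Rightarrow> nat) \<Rightarrow> bool" where
  "linear_coloring V \<Delta> k \<kappa> \<longleftrightarrow>
     \<kappa> ` V = {1..k} \<and>
     (\<forall>F\<in>facets \<Delta>. \<forall>F'\<in>facets \<Delta>.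
        size (color_mset \<kappa> F \<inter># color_mset \<kappa> F') = card (F \<inter> F'))"

definition coloring_multicomplex :: "'v set set \<Rightarrow> ('v \<Rightarrow> nat) \<Rightarrow> nat multiset set" where
  "coloring_multicomplex \<Delta> \<kappa> = color_mset \<kappa> ` \<Delta>"

definition max_multiplicity :: "nat multiset set \<Rightarrow> nat \<Rightarrow> nat" where
  "max_multiplicity \<Gamma> i = Max ((\<lambda>M. count M i) ` \<Gamma>)"

text \<open>The vertex \<open>a\<^sup>i\<^sub>r\<close> of \<open>\<Delta>(\<Gamma>)\<close> is encoded as the pair \<open>(i, r)\<close>.\<close>

definition multicomplex_vertices :: "nat \<Rightarrow> nat multiset set \<Rightarrow> (nat \<times> nat) set" where
  "multicomplex_vertices k \<Gamma> = (\<Union>i\<in>{1..k}. {(i, r) | r. 1 \<le> r \<and> r \<le> max_multiplicity \<Gamma> i})"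

definition mset_simplex :: "nat \<Rightarrow> nat multiset \<Rightarrow> (nat \<times> nat) set" where
  "mset_simplex k M = {(i, r) | i r. i \<in> {1..k} \<and> 1 \<le> r \<and> r \<le> count M i}"

definition maximal_msets :: "nat multiset set \<Rightarrow> nat multiset set" where
  "maximal_msets \<Gamma> = {M \<in> \<Gamma>. \<forall>N\<in>\<Gamma>. M \<subseteq># N \<longrightarrow> M = N}"

definition multicomplex_complex :: "nat \<Rightarrow> nat multiset set \<Rightarrow> (nat \<times> nat) set set" where
  "multicomplex_complex k \<Gamma> = {T. \<exists>M\<in>maximal_msets \<Gamma>. T \<subseteq> mset_simplex k M}"

end

theory Submission imports Defs begin

text \<open>
  Colour by colour, the linearity condition says that the multiset of colours of \<open>F \<inter> F'\<close> is
  the intersection of those of \<open>F\<close> and \<open>F'\<close>, so the vertices of a fixed colour in two facets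
  are nested. The colour class \<open>V\<^sub>i\<close> can therefore be enumerated so that each facet meets it
  in an initial segment, and sending \<open>a\<^sup>i\<^sub>r\<close> to the \<open>r\<close>-th vertex of \<open>V\<^sub>i\<close> is the isomorphism.
\<close>

text \<open>Induction on the size of \<open>X\<close>: some element lies in no member of the chain
  except possibly \<open>X\<close> itself. Removing it leaves a chain in a smaller set, and it can
  be numbered last.\<close>

lemma chain_enumeration:
  assumes "finite X" "C \<subseteq> Pow X" "\<And>A B. A \<in> C \<Longrightarrow> B \<in> C \<Longrightarrow> A \<subseteq> B \<or> B \<subseteq> A"
  shows "\<exists>g. bij_betw g {1..card X} X \<and> (\<forall>A\<in>C. g ` {1..card A} = A)"
  using assms
proof (induction "card X" arbitrary: X C)
  case 0
  then have "X = {}" "\<And>A. A \<in> C \<Longrightarrow> A = {}" by auto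
  then have "\<forall>A\<in>C. g ` {1..card A} = A" for g :: "nat \<Rightarrow> 'a" by fastforce
  then show ?case using \<open>X = {}\<close> by (simp add: bij_betw_def)
next
  case (Suc n)
  have "\<exists>x\<in>X. \<forall>A\<in>C - {X}. x \<notin> A"
  proof (rule ccontr)
    assume "\<not> ?thesis"
    \<comment> \<open>A finite set covered by a nonempty chain lies inside a single member. Here
      that member would contain \<open>X\<close> and yet be a proper subset of it.\<close>
    then have "X \<subseteq> \<Union>(C - {X})" by blast
    moreover have "X \<noteq> {}" using Suc.hyps(2) by auto
    then have "C - {X} \<noteq> {}" using calculation by (metis Sup_empty subset_empty)
    moreover have "subset.chain UNIV (C - {X})"
      using Suc.prems(3) by (auto simp: subset_chain_def)
    ultimately obtain A where "A \<in> C - {X}" "X \<subseteq> A"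
      using finite_subset_Union_chain[OF Suc.prems(1)] by metis
    then show False using Suc.prems(2) by auto
  qed
  then obtain x where x: "x \<in> X" "\<And>A. A \<in> C - {X} \<Longrightarrow> x \<notin> A" by blast
  have n: "n = card (X - {x})" using Suc x by simp
  have "finite (X - {x})" "C - {X} \<subseteq> Pow (X - {x})" using Suc.prems(1,2) x(2) by blast+
  then have "\<exists>g. bij_betw g {1..n} (X - {x}) \<and> (\<forall>A\<in>C - {X}. g ` {1..card A} = A)"
    unfolding n using Suc.prems(3) by (intro Suc.hyps(1)[OF n]) auto
  then obtain g where "bij_betw g {1..n} (X - {x}) \<and> (\<forall>A\<in>C - {X}. g ` {1..card A} = A)" ..
  then have g: "bij_betw g {1..n} (X - {x})" "\<And>A. A \<in> C - {X} \<Longrightarrow> g ` {1..card A} = A"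
    by simp_all
  \<comment> \<open>Members of \<open>C\<close> other than \<open>X\<close> avoid \<open>x\<close>
    and so have at most \<open>n\<close> elements; their initial segments never reach the new index
    \<open>Suc n\<close>.\<close>
  define h where "h = g(Suc n := x)"
  have h: "bij_betw h {1..card X} X"
  proof -
    have "bij_betw h {1..n} (X - {x})"
      using g(1) by (subst bij_betw_cong[where g = g]) (auto simp: h_def)
    then have "bij_betw h ({1..n} \<union> {Suc n}) ((X - {x}) \<union> {x})"
      by (rule bij_betw_combine) (auto simp: h_def)
    moreover have "{1..n} \<union> {Suc n} = {1..card X}" using Suc.hyps(2) by auto
    moreover have "(X - {x}) \<union> {x} = X" using x by blast
    ultimately show ?thesis by simp
  qed
  have "h ` {1..card A} = A" if A: "A \<in> C" for A
  proof (cases "A = X")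
    case True
    then show ?thesis using h by (simp add: bij_betw_def)
  next
    case False
    then have "A \<subseteq> X - {x}" using A x Suc.prems(2) by blast
    then have "card A \<le> n" using n Suc.prems(1) by (simp add: card_mono)
    then have "h ` {1..card A} = g ` {1..card A}" by (auto simp: h_def intro!: image_cong)
    then show ?thesis using g(2) A False by simp
  qed
  with h show ?case by blast
qed

lemma face_in_facet:
  assumes "finite \<Delta>" "S \<in> \<Delta>"
  obtains F where "F \<in> facets \<Delta>" "S \<subseteq> F"
  using finite_has_maximal2[OF assms] by (auto simp: facets_def)

lemma color_mset_mono: "finite T \<Longrightarrow> S \<subseteq> T \<Longrightarrow> color_mset \<kappa> S \<subseteq># color_mset \<kappa> T"
  unfolding color_mset_def by (intro image_mset_subseteq_mono) (simp add: subset_imp_msubset_mset_set)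

lemma size_color_mset [simp]: "size (color_mset \<kappa> S) = card S"
  by (simp add: color_mset_def)

locale linearly_colored_complex =
  fixes V :: "'v set" and \<Delta> :: "'v set set" and \<kappa> :: "'v \<Rightarrow> nat" and k :: nat
  assumes complex: "simplicial_complex_on V \<Delta>"
    and linear: "linear_coloring V \<Delta> k \<kappa>"
begin

abbreviation color_class :: "nat \<Rightarrow> 'v set" where
  "color_class i \<equiv> {v \<in> V. \<kappa> v = i}"

lemma finite_vertices: "finite V"
  and face_subset: "S \<in> \<Delta> \<Longrightarrow> S \<subseteq> V"
  and vertex_face: "v \<in> V \<Longrightarrow> {v} \<in> \<Delta>"
  and face_closed: "S \<in> \<Delta> \<Longrightarrow> T \<subseteq> S \<Longrightarrow> T \<in> \<Delta>"
  using complex by (auto simp: simplicial_complex_on_def)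

lemma finite_face: "S \<in> \<Delta> \<Longrightarrow> finite S"
  using face_subset finite_vertices finite_subset by blast

lemma finite_complex: "finite \<Delta>"
  using face_subset finite_vertices by (meson PowI finite_Pow_iff finite_subset subsetI)

lemma facet_face: "F \<in> facets \<Delta> \<Longrightarrow> F \<in> \<Delta>"
  by (simp add: facets_def)

text \<open>One inclusion is monotonicity. Linearity makes the two sizes equal, and a submultiset of
  the same finite size is the whole multiset.\<close>

lemma color_mset_facet_inter:
  assumes "F \<in> facets \<Delta>" "F' \<in> facets \<Delta>"
  shows "color_mset \<kappa> F \<inter># color_mset \<kappa> F' = color_mset \<kappa> (F \<inter> F')"
proof -
  have "color_mset \<kappa> (F \<inter> F') \<subseteq># color_mset \<kappa> F \<inter># color_mset \<kappa> F'"
    using assms by (simp add: color_mset_mono facet_face finite_face)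
  moreover have "size (color_mset \<kappa> F \<inter># color_mset \<kappa> F') = size (color_mset \<kappa> (F \<inter> F'))"
    using linear assms by (simp add: linear_coloring_def)
  ultimately show ?thesis
    by (metis mset_subset_size nat_neq_iff subset_mset.le_neq_trans)
qed

text \<open>Comparing the multiplicities of \<open>i\<close> in
  \<open>color_mset_facet_inter\<close> shows that the two color parts meet in as many vertices as
  the smaller one has, so the smaller one lies in the other.\<close>

lemma facets_nested_in_color:
  assumes "F \<in> facets \<Delta>" "F' \<in> facets \<Delta>"
  shows "{v \<in> F. \<kappa> v = i} \<subseteq> {v \<in> F'. \<kappa> v = i} \<or> {v \<in> F'. \<kappa> v = i} \<subseteq> {v \<in> F. \<kappa> v = i}"
proof -
  let ?A = "{v \<in> F. \<kappa> v = i}" and ?B = "{v \<in> F'. \<kappa> v = i}"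
  have fin: "finite F" "finite F'" using assms facet_face finite_face by auto
  have "{v \<in> F \<inter> F'. \<kappa> v = i} = ?A \<inter> ?B" by auto
  then have "card (?A \<inter> ?B) = min (card ?A) (card ?B)"
    using arg_cong[OF color_mset_facet_inter[OF assms], of "\<lambda>M. count M i"] fin
    by (simp add: count_color_mset)
  then have "?A \<inter> ?B = ?A \<or> ?A \<inter> ?B = ?B"
    using fin card_subset_eq[of ?A "?A \<inter> ?B"] card_subset_eq[of ?B "?A \<inter> ?B"]
    by (auto simp: min_def split: if_splits)
  then show ?thesis by blast
qed

text \<open>Containment of the color multisets forces \<open>F \<inter> F'\<close> to have the size
  of \<open>F\<close>, hence \<open>F \<subseteq> F'\<close>, and \<open>F\<close> is
  maximal.\<close>

lemma color_mset_facet_inj: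
  assumes "F \<in> facets \<Delta>" "F' \<in> facets \<Delta>" "color_mset \<kappa> F \<subseteq># color_mset \<kappa> F'"
  shows "F = F'"
proof -
  have "card F = card (F \<inter> F')"
    using color_mset_facet_inter[OF assms(1,2)] assms(3)
    by (metis size_color_mset subset_mset.inf.absorb1)
  then have "F \<inter> F' = F"
    using assms(1) facet_face finite_face by (metis Int_lower1 card_subset_eq)
  then show ?thesis using assms by (auto simp: facets_def)
qed

lemma maximal_msets_eq:
  "maximal_msets (coloring_multicomplex \<Delta> \<kappa>) = color_mset \<kappa> ` facets \<Delta>"
proof (intro equalityI subsetI)
  fix M assume M: "M \<in> maximal_msets (coloring_multicomplex \<Delta> \<kappa>)"
  then obtain S where S: "S \<in> \<Delta>" "M = color_mset \<kappa> S"
    by (auto simp: maximal_msets_def coloring_multicomplex_def)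
  obtain F where F: "F \<in> facets \<Delta>" "S \<subseteq> F" using face_in_facet[OF finite_complex S(1)] .
  then have "M \<subseteq># color_mset \<kappa> F" using S by (simp add: color_mset_mono facet_face finite_face)
  then have "M = color_mset \<kappa> F"
    using M F facet_face by (auto simp: maximal_msets_def coloring_multicomplex_def)
  then show "M \<in> color_mset \<kappa> ` facets \<Delta>" using F by blast
next
  fix M assume "M \<in> color_mset \<kappa> ` facets \<Delta>"
  then obtain F where F: "F \<in> facets \<Delta>" "M = color_mset \<kappa> F" by blast
  have "M = color_mset \<kappa> S" if S: "S \<in> \<Delta>" "M \<subseteq># color_mset \<kappa> S" for S
  proof -
    obtain F' where F': "F' \<in> facets \<Delta>" "S \<subseteq> F'" using face_in_facet[OF finite_complex S(1)] .
    \<comment> \<open>The multiset of \<open>S\<close> is squeezed between those of the facets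
      \<open>F\<close> and \<open>F'\<close>, which coincide by
      \<open>color_mset_facet_inj\<close>.\<close>
    have SF': "color_mset \<kappa> S \<subseteq># color_mset \<kappa> F'"
      using F' by (simp add: color_mset_mono facet_face finite_face)
    then have "F = F'" using color_mset_facet_inj F F' S(2) subset_mset.trans by blast
    then show ?thesis using SF' S(2) F by (simp add: subset_mset.antisym)
  qed
  then show "M \<in> maximal_msets (coloring_multicomplex \<Delta> \<kappa>)"
    using F facet_face by (auto simp: maximal_msets_def coloring_multicomplex_def)
qed

text \<open>Every vertex lies in a facet, so the color parts of the facets form a chain covering the
  class; by finiteness one of them is the whole class. This facet attains the maximal multiplicity
  of \<open>i\<close>.\<close>

lemma color_class_in_facet:
  assumes "i \<in> {1..k}"
  obtains F where "F \<in> facets \<Delta>" "color_class i = {v \<in> F. \<kappa> v = i}"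
proof -
  let ?C = "(\<lambda>F. {v \<in> F. \<kappa> v = i}) ` facets \<Delta>"
  have cover: "color_class i \<subseteq> \<Union>?C"
  proof
    fix v assume v: "v \<in> color_class i"
    then obtain F where "F \<in> facets \<Delta>" "{v} \<subseteq> F"
      using face_in_facet[OF finite_complex vertex_face] by blast
    then show "v \<in> \<Union>?C" using v by auto
  qed
  \<comment> \<open>Surjectivity of \<kappa> keeps the class nonempty, so the chain is nonempty too;
    an empty complex is possible only when \<open>V\<close> is empty.\<close>
  have "i \<in> \<kappa> ` V" using linear assms by (simp add: linear_coloring_def)
  then have "color_class i \<noteq> {}" by auto
  with cover have "?C \<noteq> {}" by blast
  moreover have "subset.chain UNIV ?C"
    using facets_nested_in_color by (auto simp: subset_chain_def)
  ultimately obtain A where A: "A \<in> ?C" "color_class i \<subseteq> A"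
    using finite_subset_Union_chain[OF _ cover] finite_vertices by auto
  then obtain F where F: "F \<in> facets \<Delta>" "A = {v \<in> F. \<kappa> v = i}" by blast
  then have "color_class i = {v \<in> F. \<kappa> v = i}" using A face_subset facet_face by blast
  with F that show thesis by blast
qed

lemma max_multiplicity_eq:
  assumes "i \<in> {1..k}"
  shows "max_multiplicity (coloring_multicomplex \<Delta> \<kappa>) i = card (color_class i)"
  unfolding max_multiplicity_def
proof (rule Max_eqI)
  show "finite ((\<lambda>M. count M i) ` coloring_multicomplex \<Delta> \<kappa>)"
    using finite_complex by (simp add: coloring_multicomplex_def)
next
  fix y assume "y \<in> (\<lambda>M. count M i) ` coloring_multicomplex \<Delta> \<kappa>"
  then obtain S where S: "S \<in> \<Delta>" "y = card {v \<in> S. \<kappa> v = i}"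
    by (auto simp: coloring_multicomplex_def count_color_mset finite_face)
  moreover have "{v \<in> S. \<kappa> v = i} \<subseteq> color_class i" using S face_subset by blast
  ultimately show "y \<le> card (color_class i)" using finite_vertices by (simp add: card_mono)
next
  obtain F where F: "F \<in> facets \<Delta>" "color_class i = {v \<in> F. \<kappa> v = i}"
    using color_class_in_facet[OF assms] .
  then have "card (color_class i) = count (color_mset \<kappa> F) i"
    by (simp add: count_color_mset facet_face finite_face)
  then show "card (color_class i) \<in> (\<lambda>M. count M i) ` coloring_multicomplex \<Delta> \<kappa>"
    using F facet_face by (auto simp: coloring_multicomplex_def)
qed

lemma vertices_eq:
  "multicomplex_vertices k (coloring_multicomplex \<Delta> \<kappa>) = Sigma {1..k} (\<lambda>i. {1..card (color_class i)})"
  using max_multiplicity_eq by (auto simp: multicomplex_vertices_def)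

lemma mset_simplex_eq:
  assumes "S \<in> \<Delta>"
  shows "mset_simplex k (color_mset \<kappa> S) = Sigma {1..k} (\<lambda>i. {1..card {v \<in> S. \<kappa> v = i}})"
  using assms by (auto simp: mset_simplex_def count_color_mset finite_face)

lemma color_bounds: "v \<in> V \<Longrightarrow> \<kappa> v \<in> {1..k}"
  using linear by (auto simp: linear_coloring_def)

lemma isomorphic:
  "simplicial_isomorphic
     (multicomplex_vertices k (coloring_multicomplex \<Delta> \<kappa>))
     (multicomplex_complex k (coloring_multicomplex \<Delta> \<kappa>)) V \<Delta>"
proof -
  let ?W = "multicomplex_vertices k (coloring_multicomplex \<Delta> \<kappa>)"
  \<comment> \<open>The enumeration is taken for every natural number \<open>i\<close>, so that
    \<open>choice\<close> applies; for \<open>i\<close> outside \<open>{1..k}\<close> the class is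
    empty.\<close>
  have "\<exists>g. bij_betw g {1..card (color_class i)} (color_class i) \<and>
      (\<forall>A\<in>(\<lambda>F. {v \<in> F. \<kappa> v = i}) ` facets \<Delta>. g ` {1..card A} = A)" for i
    using facets_nested_in_color face_subset facet_face finite_vertices
    by (intro chain_enumeration) (simp, blast, blast)
  then have "\<forall>i. \<exists>g. bij_betw g {1..card (color_class i)} (color_class i) \<and>
      (\<forall>F\<in>facets \<Delta>. g ` {1..card {v \<in> F. \<kappa> v = i}} = {v \<in> F. \<kappa> v = i})"
    by simp
  from choice[OF this] obtain g where
    g: "\<forall>i. bij_betw (g i) {1..card (color_class i)} (color_class i) \<and>
      (\<forall>F\<in>facets \<Delta>. g i ` {1..card {v \<in> F. \<kappa> v = i}} = {v \<in> F. \<kappa> v = i})" ..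
  have bij: "bij_betw (g i) {1..card (color_class i)} (color_class i)" for i
    using g by simp
  have init: "g i ` {1..card {v \<in> F. \<kappa> v = i}} = {v \<in> F. \<kappa> v = i}" if "F \<in> facets \<Delta>" for i F
    using g that by simp
  define f where "f = (\<lambda>(i, r). g i r)"
  have f_image: "f ` Sigma I B = (\<Union>i\<in>I. g i ` B i)" for I B
    by (force simp: f_def)
  have inj: "inj_on f ?W"
  proof (rule inj_onI)
    fix x y assume x: "x \<in> ?W" and y: "y \<in> ?W" and eq: "f x = f y"
    obtain i r j s where ij: "x = (i, r)" "y = (j, s)" by fastforce
    then have r: "r \<in> {1..card (color_class i)}" and s: "s \<in> {1..card (color_class j)}"
      using x y by (auto simp: vertices_eq)
    \<comment> \<open>The first coordinate is recovered as the color of the image vertex, which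
      reduces injectivity of \<open>f\<close> to that of a single \<open>g j\<close>.\<close>
    have "g i r \<in> color_class i" "g j s \<in> color_class j"
      using bij_betwE[OF bij] r s by blast+
    then have "i = j" using eq ij by (simp add: f_def)
    moreover from this have "r = s"
      using inj_onD[OF bij_betw_imp_inj_on[OF bij[of j]] _ _ s] r eq ij by (simp add: f_def)
    ultimately show "x = y" using ij by simp
  qed
  have "f ` ?W = (\<Union>i\<in>{1..k}. color_class i)"
    unfolding vertices_eq f_image using bij by (simp add: bij_betw_def)
  also have "\<dots> = V" using color_bounds by auto
  finally have "bij_betw f ?W V" using inj by (simp add: bij_betw_def)
  moreover have "T \<in> multicomplex_complex k (coloring_multicomplex \<Delta> \<kappa>) \<longleftrightarrow> f ` T \<in> \<Delta>"
    if T: "T \<subseteq> ?W" for T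
  proof -
    \<comment> \<open>By the initial segment property, \<open>f\<close> carries the simplex of
      \<open>F\<close> exactly onto \<open>F\<close>. Both \<open>T\<close> and this simplex lie in
      \<open>?W\<close>, where \<open>f\<close> is injective, so containment can be tested after
      applying \<open>f\<close>.\<close>
    have "T \<subseteq> mset_simplex k (color_mset \<kappa> F) \<longleftrightarrow> f ` T \<subseteq> F" if F: "F \<in> facets \<Delta>" for F
    proof -
      have FV: "F \<subseteq> V" using F facet_face face_subset by blast
      have "card {v \<in> F. \<kappa> v = i} \<le> card (color_class i)" for i
        using FV finite_vertices by (intro card_mono) auto
      then have sub: "mset_simplex k (color_mset \<kappa> F) \<subseteq> ?W"
        unfolding vertices_eq mset_simplex_eq[OF facet_face[OF F]]
        by (fastforce intro: order_trans)
      have "f ` mset_simplex k (color_mset \<kappa> F) = (\<Union>i\<in>{1..k}. {v \<in> F. \<kappa> v = i})"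
        unfolding mset_simplex_eq[OF facet_face[OF F]] f_image using init[OF F] by simp
      also have "\<dots> = F" using FV color_bounds by auto
      finally show ?thesis using inj_on_image_mem_iff[OF inj _ sub] T by blast
    qed
    \<comment> \<open>The faces of \<Delta> are exactly the subsets of its facets, and by
      \<open>maximal_msets_eq\<close> the generating simplices of the constructed complex are those
      of the facets.\<close>
    moreover have "(\<exists>F\<in>facets \<Delta>. f ` T \<subseteq> F) \<longleftrightarrow> f ` T \<in> \<Delta>"
      using face_in_facet[OF finite_complex] face_closed facet_face by metis
    ultimately show ?thesis by (auto simp: multicomplex_complex_def maximal_msets_eq)
  qed
  ultimately show ?thesis unfolding simplicial_isomorphic_def by blast
qed

end

theorem theorem3p6:
  fixes V :: "'v set" and \<Delta> :: "'v set set" and \<kappa> :: "'v \<Rightarrow> nat" and k :: nat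
  assumes "simplicial_complex_on V \<Delta>"
    and "linear_coloring V \<Delta> k \<kappa>"
  shows "simplicial_isomorphic
           (multicomplex_vertices k (coloring_multicomplex \<Delta> \<kappa>))
           (multicomplex_complex k (coloring_multicomplex \<Delta> \<kappa>))
           V \<Delta>"
  using assms by (intro linearly_colored_complex.isomorphic linearly_colored_complex.intro)

end
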